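(* Let $\mathbb{k}$ be a field. If $\ell:\mathbb{Z}\hookrightarrow\mathbb{Z}^2$ is an injective monotonic map and $M\in\mathrm{rep}_0(\mathbb{Z}^2)$, then $$\mathcal{N}^2(M)\;\ge\;\mathcal{N}^1(\ell^*(M)).$$
   Context: $\mathbb{Z}$ has its usual order and $\mathbb{Z}^2$ the product order. For $n=1,2$, $\mathrm{rep}_0(\mathbb{Z}^n)$ is the category of functors $\mathbb{Z}^n\to\mathrm{vec}$ (finite dimensional $\mathbb{k}$-vector spaces) with finite support. A representation $M$ of $\mathbb{Z}^2$ is identified with a bigraded $\mathbb{k}[\mathbf{x},\mathbf{y}]$-module, with $\mathbf{x}:M_i\to M_{i+(1,0)}$ and $\mathbf{y}:M_i\to M_{i+(0,1)}$ the structure maps. The two-parameter count is $\mathcal{N}^2(M)=\dim M-\dim\mathbf{x}M-\dim\mathbf{y}M+\dim\mathbf{x}\mathbf{y}M$ (total dimensions over $\mathbb{k}$). For $A\in\mathrm{rep}_0(\mathbb{Z})$, $\mathcal{N}^1(A)$ is the number of indecomposable summands of $A$, counted with multiplicity. $\ell^*(M)=M\circ\ell$. *)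

theory Defs
  imports Complex_Main "HOL-Library.Product_Order" "HOL-Library.Product_Plus" "HOL-Library.FuncSet"
begin

(* All spaces of a representation are subspaces of one ambient vector space, e.g. of the
   direct sum of all of them; structure maps only matter on these subspaces. *)
record ('i, 'v) rep =
  space_at :: "'i \<Rightarrow> 'v set"
  smap :: "'i \<Rightarrow> 'i \<Rightarrow> 'v \<Rightarrow> 'v"

definition pullback :: "('i \<Rightarrow> 'j) \<Rightarrow> ('j, 'v) rep \<Rightarrow> ('i, 'v) rep" where
  "pullback l M = \<lparr>space_at = (\<lambda>i. space_at M (l i)), smap = (\<lambda>i j. smap M (l i) (l j))\<rparr>"

(* For a submodule W (a family of graded pieces) this is the family of graded pieces of
   xW or yW, for d = (1,0) or d = (0,1) respectively. *)
definition shift_image ::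
    "int \<times> int \<Rightarrow> (int \<times> int, 'v) rep \<Rightarrow> (int \<times> int \<Rightarrow> 'v set) \<Rightarrow> (int \<times> int \<Rightarrow> 'v set)" where
  "shift_image d M W = (\<lambda>i. smap M (i - d) i ` W (i - d))"

definition linear_map_between ::
    "('k::field \<Rightarrow> 'v::ab_group_add \<Rightarrow> 'v) \<Rightarrow> 'v set \<Rightarrow> 'v set \<Rightarrow> ('v \<Rightarrow> 'v) \<Rightarrow> bool" where
  "linear_map_between scale S T f \<longleftrightarrow> f ` S \<subseteq> T \<and>
     (\<forall>u\<in>S. \<forall>v\<in>S. f (u + v) = f u + f v) \<and> (\<forall>c. \<forall>v\<in>S. f (scale c v) = scale c (f v))"

definition rep0 ::
    "('k::field \<Rightarrow> 'v::ab_group_add \<Rightarrow> 'v) \<Rightarrow> ('i::order, 'v) rep \<Rightarrow> bool" where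
  "rep0 scale M \<longleftrightarrow>
     (\<forall>i. module.subspace scale (space_at M i) \<and> (\<exists>B. finite B \<and> module.span scale B = space_at M i)) \<and>
     (\<forall>i j. i \<le> j \<longrightarrow> linear_map_between scale (space_at M i) (space_at M j) (smap M i j)) \<and>
     (\<forall>i. \<forall>v\<in>space_at M i. smap M i i v = v) \<and>
     (\<forall>i j k. i \<le> j \<longrightarrow> j \<le> k \<longrightarrow>
        (\<forall>v\<in>space_at M i. smap M j k (smap M i j v) = smap M i k v)) \<and>
     finite {i. space_at M i \<noteq> {0}}"

definition total_dim ::
    "('k::field \<Rightarrow> 'v::ab_group_add \<Rightarrow> 'v) \<Rightarrow> ('i \<Rightarrow> 'v set) \<Rightarrow> nat" where
  "total_dim scale W = (\<Sum>i | W i \<noteq> {0}. vector_space.dim scale (W i))"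

definition count2 ::
    "('k::field \<Rightarrow> 'v::ab_group_add \<Rightarrow> 'v) \<Rightarrow> (int \<times> int, 'v) rep \<Rightarrow> int" where
  "count2 scale M =
     int (total_dim scale (space_at M))
     - int (total_dim scale (shift_image (1,0) M (space_at M)))
     - int (total_dim scale (shift_image (0,1) M (space_at M)))
     + int (total_dim scale (shift_image (1,0) M (shift_image (0,1) M (space_at M))))"

definition subrep ::
    "('k::field \<Rightarrow> 'v::ab_group_add \<Rightarrow> 'v) \<Rightarrow> ('i::order \<Rightarrow> 'v set) \<Rightarrow> ('i, 'v) rep \<Rightarrow> bool" where
  "subrep scale W M \<longleftrightarrow>
     (\<forall>i. module.subspace scale (W i) \<and> W i \<subseteq> space_at M i) \<and>
     (\<forall>i j. i \<le> j \<longrightarrow> smap M i j ` W i \<subseteq> W j)"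

definition is_direct_sum ::
    "('k::field \<Rightarrow> 'v::ab_group_add \<Rightarrow> 'v) \<Rightarrow> ('i::order, 'v) rep \<Rightarrow> nat \<Rightarrow> (nat \<Rightarrow> 'i \<Rightarrow> 'v set) \<Rightarrow> bool" where
  "is_direct_sum scale M n W \<longleftrightarrow>
     (\<forall>k<n. subrep scale (W k) M) \<and>
     (\<forall>i. bij_betw (\<lambda>w. \<Sum>k<n. w k) (\<Pi>\<^sub>E k\<in>{..<n}. W k i) (space_at M i))"

definition indecomposable ::
    "('k::field \<Rightarrow> 'v::ab_group_add \<Rightarrow> 'v) \<Rightarrow> ('i::order, 'v) rep \<Rightarrow> bool" where
  "indecomposable scale M \<longleftrightarrow>
     (\<exists>i. space_at M i \<noteq> {0}) \<and>
     (\<forall>W. is_direct_sum scale M 2 W \<longrightarrow> (\<forall>i. W 0 i = {0}) \<or> (\<forall>i. W 1 i = {0}))"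

(* The number of summands exists and is unique for representations satisfying rep0
   (Krull-Remak-Schmidt). *)
definition count1 ::
    "('k::field \<Rightarrow> 'v::ab_group_add \<Rightarrow> 'v) \<Rightarrow> (int, 'v) rep \<Rightarrow> nat" where
  "count1 scale A = (THE n. \<exists>W. is_direct_sum scale A n W \<and>
                 (\<forall>k<n. indecomposable scale (A\<lparr>space_at := W k\<rparr>)))"

lemma rep0_pullback:
  fixes l :: "'i::order \<Rightarrow> 'j::order"
  assumes "rep0 scale M" "mono l" "inj l"
  shows "rep0 scale (pullback l M)"
proof -
  have "finite (l -` {i. space_at M i \<noteq> {0}})"
    using assms by (intro finite_vimageI) (auto simp: rep0_def)
  then have "finite {i. space_at M (l i) \<noteq> {0}}"
    by (simp add: vimage_def)
  moreover have "i \<le> j \<Longrightarrow> l i \<le> l j" for i j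
    using assms(2) by (rule monoD)
  ultimately show ?thesis
    using assms(1) unfolding rep0_def pullback_def by simp
qed

end

(* For a representation A of the integers, the number of indecomposable summands is
   sum_s (dim A_s - rank (A_s -> A_(s+1))): this number is additive, it is positive unless A = 0,
   and every nonzero A has a direct summand (an interval module) on which it equals 1. Call it
   N(A). By subadditivity of the nullity, N can only grow when a chain is refined, so l may be
   replaced by a bi-infinite lattice path with unit steps. For such a path, the dimensions, edge
   ranks and square ranks in the two-parameter count that are not used up by N are distributed
   to the points off the path. A point p above the path receives
     dim M_p - rank x|M_p - dim yM + rank x|yM   (yM taken in degree p),
   which is nonnegative since yM is a subspace of M_p; symmetrically below the path. *)

theory Submission
  imports Defs "HOL-Library.Groups_Big_Fun"
begin

section \<open>Finite dimensional subspaces\<close>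

text \<open>\<open>count1\<close> is a definite description, so n must be shown to exist and to be
  unique. An additive invariant with value 1 on every indecomposable gives uniqueness; the value 1
  holds because an indecomposable must coincide with any interval that splits off. The detour
  through a unit-step path is forced by the shape of \<open>count2\<close>: it contains only ranks
  of grid edges and of diagonals of unit squares, while a step of l may jump further and have a rank
  that does not occur there. A path point keeps its dimension and the edge by which the path leaves
  it. Its other outgoing edge and its unit square are charged to the end of that other edge, which
  lies off the path. Since the path only goes right or up, the region above is closed under adding
  (0,1) and the region below under adding (1,0), so charging vertical edges above and horizontal
  edges below to their ends is consistent. The rank inequalities all come from one fact: the nullity
  of a linear map does not grow on restriction to a subspace.\<close>

locale ambient_space = vector_space scale
  for scale :: "'a::field \<Rightarrow> 'b::ab_group_add \<Rightarrow> 'b" (infixr \<open>*s\<close> 75)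
begin

text \<open>Finiteness is carried along explicitly because \<open>dim\<close> is 0 on infinite
  dimensional subspaces and the ambient space may have any dimension.\<close>

definition findim :: "'b set \<Rightarrow> bool" where
  "findim V \<longleftrightarrow> subspace V \<and> (\<exists>B. finite B \<and> span B = V)"

lemma findim_subspace: "findim V \<Longrightarrow> subspace V"
  by (simp add: findim_def)

lemma findim_zero: "findim {0}"
  unfolding findim_def using span_empty by (metis finite.emptyI subspace_single_0)

lemma basis_pair_exists:
  assumes V: "findim V" and W: "subspace W" "W \<subseteq> V"
  obtains B C where "B \<subseteq> C" "finite C" "independent C" "span B = W" "span C = V"
    "card B = dim W" "card C = dim V"
proof -
  obtain S where S: "finite S" "span S = V" and V': "subspace V"
    using V by (auto simp: findim_def)
  obtain B where B: "B \<subseteq> W" "independent B" "W \<subseteq> span B"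
    using maximal_independent_subset by blast
  obtain C where C: "B \<subseteq> C" "C \<subseteq> V" "independent C" "V \<subseteq> span C"
    using maximal_independent_subset_extend[of B V] B W by blast
  have "finite C"
    using independent_span_bound[of S C] C S by simp
  moreover have "span B = W" "span C = V"
    using B C W V' by (metis span_minimal subset_antisym)+
  moreover have "card B = dim W" "card C = dim V"
    using B C by (auto intro: basis_card_eq_dim)
  ultimately show ?thesis
    using that B C by blast
qed

lemma findim_basis:
  assumes "findim V"
  obtains B where "finite B" "independent B" "span B = V" "card B = dim V"
  using basis_pair_exists[OF assms findim_subspace[OF assms]] by blast

lemma findim_subset:
  assumes "findim V" "subspace W" "W \<subseteq> V"
  shows "findim W"
proof -
  obtain B C where "B \<subseteq> C" "finite C" "span B = W"
    using basis_pair_exists[OF assms] by metis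
  then show ?thesis
    using assms(2) finite_subset unfolding findim_def by blast
qed

lemma dim_singleton_zero: "dim {0} = 0"
  using dim_le_card[of "{0}" "{}"] by simp

lemma dim_span_singleton: "v \<noteq> 0 \<Longrightarrow> dim (span {v}) = 1"
  by (simp add: dim_eq_card_independent)

lemma dim_pos:
  assumes "findim V" "V \<noteq> {0}"
  shows "dim V > 0"
proof (rule ccontr)
  assume "\<not> dim V > 0"
  moreover obtain B where "finite B" "span B = V" "card B = dim V"
    using findim_basis[OF assms(1)] by metis
  ultimately show False
    using assms(2) by auto
qed

lemma linear_map_between_subset:
  assumes "linear_map_between scale S T f" "S' \<subseteq> S" "f ` S' \<subseteq> T'"
  shows "linear_map_between scale S' T' f"
  using assms unfolding linear_map_between_def by blast

text \<open>Structure maps are linear only on the spaces where they start; a global extension makes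
  the library facts about images of spans and sums applicable.\<close>

lemma linear_map_extend:
  assumes "findim V" "linear_map_between scale V T f"
  obtains g where "Vector_Spaces.linear scale scale g" "\<And>v. v \<in> V \<Longrightarrow> g v = f v"
proof -
  interpret P: vector_space_pair scale scale
    by unfold_locales
  have V: "subspace V"
    using assms(1) by (rule findim_subspace)
  obtain B where B: "independent B" "span B = V"
    using findim_basis[OF assms(1)] by metis
  obtain g where g: "Vector_Spaces.linear scale scale g" "\<And>b. b \<in> B \<Longrightarrow> g b = f b"
    using P.linear_independent_extend[OF B(1)] by metis
  have f0: "f 0 = 0"
    using assms(2) subspace_0[OF V] unfolding linear_map_between_def by (metis scale_zero_left)
  have "g v = f v" if "v \<in> V" for v
  proof -
    have "v \<in> span B"
      using that B by simp
    then have "v \<in> V \<and> g v = f v"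
    proof (induction rule: span_induct_alt)
      case base
      then show ?case
        using f0 P.linear_0[OF g(1)] subspace_0[OF V] by simp
    next
      case (step c x y)
      have x: "x \<in> V"
        using step.hyps(1) B(2) span_base by blast
      then have "f (c *s x + y) = c *s f x + f y"
        using assms(2) step subspace_scale[OF V] unfolding linear_map_between_def by metis
      then show ?case
        using step x g subspace_scale[OF V] subspace_add[OF V]
        by (simp add: P.linear_add[OF g(1)] P.linear_scale[OF g(1)])
    qed
    then show ?thesis by simp
  qed
  then show ?thesis
    using that g by blast
qed

lemma findim_image:
  assumes "findim V" "linear_map_between scale V T f"
  shows "findim (f ` V)"
proof -
  interpret P: vector_space_pair scale scale
    by unfold_locales
  obtain g where g: "Vector_Spaces.linear scale scale g" "\<And>v. v \<in> V \<Longrightarrow> g v = f v"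
    using linear_map_extend[OF assms] by metis
  obtain B where B: "finite B" "span B = V"
    using assms(1) by (auto simp: findim_def)
  have "f ` V = span (g ` B)"
    using g(2) B P.linear_span_image[OF g(1), of B] by (metis image_cong)
  then show ?thesis
    using B unfolding findim_def by (metis finite_imageI subspace_span)
qed

text \<open>Both sides are dimensions of kernels, and the kernel on W lies in the kernel on V. The
  proof works with bases instead: extending a basis of W to one of V shows that the image of V is
  spanned by a basis of the image of W and at most dim V - dim W further vectors.\<close>

lemma nullity_mono:
  assumes V: "findim V" "linear_map_between scale V T f" and W: "subspace W" "W \<subseteq> V"
  shows "int (dim W) - int (dim (f ` W)) \<le> int (dim V) - int (dim (f ` V))"
proof -
  interpret P: vector_space_pair scale scale
    by unfold_locales
  obtain g where g: "Vector_Spaces.linear scale scale g" "\<And>v. v \<in> V \<Longrightarrow> g v = f v"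
    using linear_map_extend[OF V] by metis
  have fV: "f ` V = g ` V" and fW: "f ` W = g ` W"
    using g(2) W(2) by (auto intro!: image_cong)
  obtain B C where BC: "B \<subseteq> C" "finite C" "span B = W" "span C = V"
    "card B = dim W" "card C = dim V"
    using basis_pair_exists[OF V(1) W] by metis
  have "findim (f ` W)"
    using findim_image[OF findim_subset[OF V(1) W] linear_map_between_subset[OF V(2) W(2)]] by blast
  then obtain D where D: "finite D" "span D = g ` W" "card D = dim (g ` W)"
    using findim_basis fW by metis
  have "g ` V = span (g ` C)"
    using P.linear_span_image[OF g(1), of C] BC by simp
  also have "\<dots> \<subseteq> span (D \<union> g ` (C - B))"
  proof (rule span_minimal)
    have "g ` B \<subseteq> span D"
      using D BC span_superset by blast
    also have "span D \<subseteq> span (D \<union> g ` (C - B))"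
      by (rule span_mono) simp
    finally have "g ` B \<subseteq> span (D \<union> g ` (C - B))" .
    moreover have "g ` (C - B) \<subseteq> span (D \<union> g ` (C - B))"
      using span_superset[of "D \<union> g ` (C - B)"] by simp
    ultimately show "g ` C \<subseteq> span (D \<union> g ` (C - B))"
      by blast
  qed simp
  finally have "dim (g ` V) \<le> card (D \<union> g ` (C - B))"
    using D BC by (intro dim_le_card) auto
  also have "\<dots> \<le> card D + card (g ` (C - B))"
    by (rule card_Un_le)
  also have "card (g ` (C - B)) \<le> card (C - B)"
    using BC by (intro card_image_le) auto
  also have "card (C - B) = card C - card B"
    using BC by (simp add: card_Diff_subset finite_subset)
  finally have "dim (g ` V) \<le> dim (g ` W) + (dim V - dim W)"
    using D BC by simp
  moreover have "dim W \<le> dim V"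
    using BC by (metis card_mono)
  ultimately show ?thesis
    using fV fW by simp
qed

lemma dim_image_le_dim:
  assumes "findim V" "linear_map_between scale V T f"
  shows "dim (f ` V) \<le> dim V"
proof -
  have "0 \<in> V"
    using assms(1) findim_subspace subspace_0 by blast
  moreover have "f 0 = 0"
    using assms(2) calculation unfolding linear_map_between_def by (metis scale_zero_left)
  ultimately show ?thesis
    using nullity_mono[OF assms subspace_single_0] by (simp add: dim_singleton_zero)
qed

section \<open>Direct sums\<close>

definition dir_sum :: "nat \<Rightarrow> (nat \<Rightarrow> 'b set) \<Rightarrow> 'b set \<Rightarrow> bool" where
  "dir_sum n U V \<longleftrightarrow> bij_betw (\<lambda>w. \<Sum>k<n. w k) (\<Pi>\<^sub>E k\<in>{..<n}. U k) V"

definition complementary :: "'b set \<Rightarrow> 'b set \<Rightarrow> 'b set \<Rightarrow> bool" where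
  "complementary S T V \<longleftrightarrow> S \<inter> T = {0} \<and> V = {s + t |s t. s \<in> S \<and> t \<in> T}"

text \<open>The pair is (t, s), with the summand to be added in front, because
  \<open>PiE_insert_eq\<close> puts the value at the inserted index first.\<close>

lemma complementary_bij_betw:
  assumes "subspace S" "subspace T"
  shows "complementary S T V \<longleftrightarrow> bij_betw (\<lambda>(t, s). s + t) (T \<times> S) V"
proof -
  have "S \<inter> T = {0} \<longleftrightarrow> inj_on (\<lambda>(t, s). s + t) (T \<times> S)"
  proof
    assume ST: "S \<inter> T = {0}"
    show "inj_on (\<lambda>(t, s). s + t) (T \<times> S)"
    proof (rule inj_onI, clarify)
      fix t s t' s'
      assume H: "t \<in> T" "s \<in> S" "t' \<in> T" "s' \<in> S" "s + t = s' + t'"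
      then have "s - s' = t' - t"
        by (simp add: algebra_simps)
      moreover have "s - s' \<in> S" "t' - t \<in> T"
        using H assms subspace_diff by auto
      ultimately have "s - s' \<in> S \<inter> T" "t' - t \<in> S \<inter> T"
        by auto
      then show "t = t' \<and> s = s'"
        unfolding ST by simp
    qed
  next
    assume inj: "inj_on (\<lambda>(t, s). s + t) (T \<times> S)"
    have "x = 0" if "x \<in> S" "x \<in> T" for x
      using inj_onD[OF inj, of "(x, - x)" "(0, 0)"] that assms subspace_neg subspace_0 by auto
    then show "S \<inter> T = {0}"
      using assms subspace_0 by auto
  qed
  moreover have "(\<lambda>(t, s). s + t) ` (T \<times> S) = {s + t |s t. s \<in> S \<and> t \<in> T}"
    by auto
  ultimately show ?thesis
    unfolding complementary_def bij_betw_def by auto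
qed

lemma dir_sum_0: "dir_sum 0 U V \<longleftrightarrow> V = {0}"
  by (auto simp: dir_sum_def bij_betw_def)

text \<open>Separating the value at n from the other values is a bijection, and so is summing the
  latter, by the assumption on C. Up to these two bijections the sum of \<open>Suc n\<close> terms
  is binary addition.\<close>

lemma dir_sum_Suc:
  assumes "dir_sum n U C"
  shows "dir_sum (Suc n) U V \<longleftrightarrow> bij_betw (\<lambda>(t, s). s + t) (U n \<times> C) V"
proof -
  let ?P = "\<Pi>\<^sub>E k\<in>{..<n}. U k"
  have PiE: "(\<Pi>\<^sub>E k\<in>{..<Suc n}. U k) = (\<lambda>(y, g). g(n := y)) ` (U n \<times> ?P)"
    by (simp add: lessThan_Suc PiE_insert_eq)
  have 1: "bij_betw (\<lambda>(y, g). g(n := y)) (U n \<times> ?P) (\<Pi>\<^sub>E k\<in>{..<Suc n}. U k)"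
    unfolding PiE by (intro inj_on_imp_bij_betw inj_combinator) simp
  have 2: "bij_betw (map_prod id (\<lambda>w. \<Sum>k<n. w k)) (U n \<times> ?P) (U n \<times> C)"
    using assms by (intro bij_betw_map_prod) (auto simp: dir_sum_def)
  have "dir_sum (Suc n) U V \<longleftrightarrow>
      bij_betw ((\<lambda>w. \<Sum>k<Suc n. w k) \<circ> (\<lambda>(y, g). g(n := y))) (U n \<times> ?P) V"
    unfolding dir_sum_def by (rule bij_betw_comp_iff[OF 1])
  also have "((\<lambda>w. \<Sum>k<Suc n. w k) \<circ> (\<lambda>(y, g). g(n := y))) =
      (\<lambda>(t, s). s + t) \<circ> map_prod id (\<lambda>w. \<Sum>k<n. w k)"
    by (auto simp: fun_eq_iff)
  also have "bij_betw \<dots> (U n \<times> ?P) V \<longleftrightarrow> bij_betw (\<lambda>(t, s). s + t) (U n \<times> C) V"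
    by (rule bij_betw_comp_iff[OF 2, symmetric])
  finally show ?thesis .
qed

lemma dir_sum_SucI:
  assumes "dir_sum n U C" "subspace C" "subspace (U n)" "complementary C (U n) V"
  shows "dir_sum (Suc n) U V"
  using assms complementary_bij_betw dir_sum_Suc by blast

lemma dir_sum_cong:
  assumes "\<And>k. k < n \<Longrightarrow> U k = U' k"
  shows "dir_sum n U V \<longleftrightarrow> dir_sum n U' V"
  using PiE_cong[of "{..<n}" U U'] assms by (simp add: dir_sum_def)

lemma dir_sum_imp_subspace:
  assumes "dir_sum n U V" "\<And>k. k < n \<Longrightarrow> subspace (U k)"
  shows "subspace V"
proof -
  have V: "V = (\<lambda>w. \<Sum>k<n. w k) ` (\<Pi>\<^sub>E k\<in>{..<n}. U k)"
    using assms(1) by (simp add: dir_sum_def bij_betw_def)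
  have I: "(\<Sum>k<n. w k) \<in> V" if "\<And>k. k < n \<Longrightarrow> w k \<in> U k" for w
    unfolding V using that
    by (intro image_eqI[where x = "restrict w {..<n}"]) auto
  show ?thesis
  proof (rule subspaceI)
    show "0 \<in> V"
      using I[of "\<lambda>_. 0"] assms(2) subspace_0 by simp
  next
    fix x y assume "x \<in> V" "y \<in> V"
    then obtain u w where "x = (\<Sum>k<n. u k)" "u \<in> (\<Pi>\<^sub>E k\<in>{..<n}. U k)"
      "y = (\<Sum>k<n. w k)" "w \<in> (\<Pi>\<^sub>E k\<in>{..<n}. U k)"
      unfolding V by auto
    then show "x + y \<in> V"
      using I[of "\<lambda>k. u k + w k"] assms(2) subspace_add by (auto simp: sum.distrib PiE_iff)
  next
    fix c x assume "x \<in> V"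
    then obtain u where "x = (\<Sum>k<n. u k)" "u \<in> (\<Pi>\<^sub>E k\<in>{..<n}. U k)"
      unfolding V by auto
    then show "c *s x \<in> V"
      using I[of "\<lambda>k. c *s u k"] assms(2) subspace_scale by (auto simp: scale_sum_right PiE_iff)
  qed
qed

lemma dir_sum_SucE:
  assumes "dir_sum (Suc n) U V" "\<And>k. k \<le> n \<Longrightarrow> subspace (U k)"
  obtains C where "dir_sum n U C" "subspace C" "complementary C (U n) V"
proof -
  let ?P = "\<Pi>\<^sub>E k\<in>{..<n}. U k"
  define C where "C = (\<lambda>w. \<Sum>k<n. w k) ` ?P"
  have inj: "inj_on (\<lambda>w. \<Sum>k<Suc n. w k) (\<Pi>\<^sub>E k\<in>{..<Suc n}. U k)"
    using assms(1) by (simp add: dir_sum_def bij_betw_def)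
  have "inj_on (\<lambda>w. \<Sum>k<n. w k) ?P"
  proof (rule inj_onI)
    fix u w assume H: "u \<in> ?P" "w \<in> ?P" "(\<Sum>k<n. u k) = (\<Sum>k<n. w k)"
    \<comment> \<open>Padding by 0 at n turns families over the first n indices into longer ones
      with the same sum, so injectivity is inherited.\<close>
    have "0 \<in> U n"
      using assms(2) subspace_0 by simp
    then have "u(n := 0) \<in> (\<Pi>\<^sub>E k\<in>{..<Suc n}. U k)" "w(n := 0) \<in> (\<Pi>\<^sub>E k\<in>{..<Suc n}. U k)"
      unfolding lessThan_Suc using H(1,2) by (simp_all add: PiE_fun_upd)
    moreover have "(\<Sum>k<Suc n. (u(n := 0)) k) = (\<Sum>k<Suc n. (w(n := 0)) k)"
      using H(3) by simp
    ultimately have *: "u(n := 0) = w(n := 0)"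
      using inj_onD[OF inj] by blast
    show "u = w"
    proof
      fix k
      show "u k = w k"
        using fun_cong[OF *, of k] PiE_arb[OF H(1), of n] PiE_arb[OF H(2), of n]
        by (cases "k = n") simp_all
    qed
  qed
  then have C: "dir_sum n U C"
    unfolding dir_sum_def C_def by (rule inj_on_imp_bij_betw)
  then have "subspace C"
    using assms(2) by (rule dir_sum_imp_subspace) simp
  moreover have "complementary C (U n) V"
    using assms(1) unfolding complementary_bij_betw[OF calculation assms(2)[OF order_refl]]
      dir_sum_Suc[OF C] .
  ultimately show ?thesis
    using that[OF C] by simp
qed

text \<open>The union of two bases spans V, which bounds dim V from above. The lower bound is
  \<open>nullity_mono\<close> for the projection f onto T along S: it kills S and has image
  T.\<close>

lemma dim_complementary:
  assumes "complementary S T V" "findim S" "findim T"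
  shows "findim V" "dim V = dim S + dim T"
proof -
  have S: "subspace S" and T: "subspace T"
    using assms findim_subspace by auto
  have V: "V = {s + t |s t. s \<in> S \<and> t \<in> T}" and ST: "S \<inter> T = {0}"
    using assms(1) by (auto simp: complementary_def)
  obtain B where B: "finite B" "span B = S" "card B = dim S"
    using findim_basis[OF assms(2)] by metis
  obtain C where C: "finite C" "span C = T" "card C = dim T"
    using findim_basis[OF assms(3)] by metis
  have span: "span (B \<union> C) = V"
    using B C V by (auto simp: span_Un)
  then show V': "findim V"
    using B C subspace_span unfolding findim_def by (metis finite_UnI)
  have "dim V \<le> card (B \<union> C)"
    using B C span by (intro dim_le_card) auto
  also have "\<dots> \<le> dim S + dim T"
    using B C card_Un_le by metis
  finally have le: "dim V \<le> dim S + dim T" .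
  define f where "f v = (THE t. t \<in> T \<and> v - t \<in> S)" for v
  have f: "f (s + t) = t" if "s \<in> S" "t \<in> T" for s t
    unfolding f_def
  proof (rule the_equality)
    fix t' assume t': "t' \<in> T \<and> s + t - t' \<in> S"
    then have "t - t' \<in> T"
      using that T subspace_diff by blast
    moreover have "(s + t - t') - s \<in> S"
      using t' that S subspace_diff by blast
    ultimately have "t - t' \<in> S \<inter> T"
      by (simp add: algebra_simps)
    then show "t' = t"
      using ST by auto
  qed (use that in auto)
  have lin: "linear_map_between scale V UNIV f"
    unfolding linear_map_between_def
  proof (intro conjI ballI allI)
    fix u v assume "u \<in> V" "v \<in> V"
    then obtain s t s' t' where *: "u = s + t" "v = s' + t'" "s \<in> S" "t \<in> T" "s' \<in> S" "t' \<in> T"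
      unfolding V by blast
    then have "f ((s + s') + (t + t')) = t + t'"
      using S T by (intro f) (auto intro: subspace_add)
    then show "f (u + v) = f u + f v"
      using * f by (simp add: algebra_simps)
  next
    fix c v assume "v \<in> V"
    then obtain s t where *: "v = s + t" "s \<in> S" "t \<in> T"
      unfolding V by blast
    then have "f (c *s s + c *s t) = c *s t"
      using S T by (intro f) (auto intro: subspace_scale)
    then show "f (c *s v) = c *s f v"
      using * f by (simp add: scale_right_distrib)
  qed simp
  have "S \<subseteq> V"
    using subspace_0[OF T] unfolding V by force
  moreover have "f ` V = T"
    using f subspace_0[OF S] unfolding V by force
  moreover have "f ` S = {0}"
    using f[of _ 0] subspace_0[OF S] subspace_0[OF T] by force
  ultimately show "dim V = dim S + dim T"
    using nullity_mono[OF V' lin S \<open>S \<subseteq> V\<close>] le by (simp add: dim_singleton_zero)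
qed

lemma dim_dir_sum:
  assumes "dir_sum n U V" "\<And>k. k < n \<Longrightarrow> findim (U k)"
  shows "findim V \<and> dim V = (\<Sum>k<n. dim (U k))"
  using assms
proof (induction n arbitrary: V)
  case 0
  then show ?case
    by (simp add: dir_sum_0 findim_zero dim_singleton_zero)
next
  case (Suc n)
  obtain C where C: "dir_sum n U C" "complementary C (U n) V"
    using dir_sum_SucE[OF Suc.prems(1)] Suc.prems(2) findim_subspace by (metis less_Suc_eq_le)
  have "findim C \<and> dim C = (\<Sum>k<n. dim (U k))"
    using Suc C by auto
  then show ?case
    using dim_complementary[OF C(2)] Suc.prems(2) by auto
qed

text \<open>The map f need not be injective. Uniqueness of the summands in the image comes from the
  decomposition of V', which f respects.\<close>

lemma dir_sum_image:
  assumes V: "dir_sum n U V" "\<And>k. k < n \<Longrightarrow> U k \<subseteq> V" "findim V" "linear_map_between scale V T f"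
    and V': "dir_sum n U' V'" "\<And>k. k < n \<Longrightarrow> f ` U k \<subseteq> U' k"
  shows "dir_sum n (\<lambda>k. f ` U k) (f ` V)"
proof -
  interpret P: vector_space_pair scale scale
    by unfold_locales
  obtain g where g: "Vector_Spaces.linear scale scale g" "\<And>v. v \<in> V \<Longrightarrow> g v = f v"
    using linear_map_extend[OF V(3,4)] by metis
  let ?S = "\<lambda>w. \<Sum>k<n. w k"
  have VI: "V = ?S ` (\<Pi>\<^sub>E k\<in>{..<n}. U k)"
    using V(1) by (simp add: dir_sum_def bij_betw_def)
  have sum: "f (?S w) = (\<Sum>k<n. f (w k))" if "w \<in> (\<Pi>\<^sub>E k\<in>{..<n}. U k)" for w
  proof -
    have "f (?S w) = g (?S w)"
      using that g(2) VI by auto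
    also have "\<dots> = (\<Sum>k<n. g (w k))"
      by (rule P.linear_sum[OF g(1)])
    also have "\<dots> = (\<Sum>k<n. f (w k))"
      using that g(2) V(2) by (intro sum.cong) (auto simp: PiE_iff)
    finally show ?thesis .
  qed
  have "inj_on ?S (\<Pi>\<^sub>E k\<in>{..<n}. f ` U k)"
  proof (rule inj_on_subset)
    show "inj_on ?S (\<Pi>\<^sub>E k\<in>{..<n}. U' k)"
      using V'(1) by (simp add: dir_sum_def bij_betw_def)
    show "(\<Pi>\<^sub>E k\<in>{..<n}. f ` U k) \<subseteq> (\<Pi>\<^sub>E k\<in>{..<n}. U' k)"
      using V'(2) by (intro PiE_mono) simp
  qed
  moreover have "?S ` (\<Pi>\<^sub>E k\<in>{..<n}. f ` U k) = f ` V"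
  proof safe
    fix w assume w: "w \<in> (\<Pi>\<^sub>E k\<in>{..<n}. f ` U k)"
    then have "\<forall>k\<in>{..<n}. \<exists>u. u \<in> U k \<and> w k = f u"
      by (auto simp: PiE_iff)
    then obtain u where u: "\<And>k. k < n \<Longrightarrow> u k \<in> U k \<and> w k = f (u k)"
      unfolding bchoice_iff by auto
    then have "restrict u {..<n} \<in> (\<Pi>\<^sub>E k\<in>{..<n}. U k)"
      by auto
    moreover have "?S w = f (?S (restrict u {..<n}))"
      using sum[OF calculation] u by auto
    ultimately show "?S w \<in> f ` V"
      unfolding VI by blast
  next
    fix v assume "v \<in> V"
    then obtain u where u: "u \<in> (\<Pi>\<^sub>E k\<in>{..<n}. U k)" "v = ?S u"
      unfolding VI by auto
    then have "f v = ?S (\<lambda>k\<in>{..<n}. f (u k))"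
      using sum by simp
    moreover have "(\<lambda>k\<in>{..<n}. f (u k)) \<in> (\<Pi>\<^sub>E k\<in>{..<n}. f ` U k)"
      using u by (auto simp: PiE_iff)
    ultimately show "f v \<in> ?S ` (\<Pi>\<^sub>E k\<in>{..<n}. f ` U k)"
      by blast
  qed
  ultimately show ?thesis
    by (simp add: dir_sum_def bij_betw_def)
qed

section \<open>Counting the summands of a representation of the integers\<close>

lemma rep0_findim: "rep0 scale A \<Longrightarrow> findim (space_at A i)"
  by (simp add: rep0_def findim_def)

lemma rep0_subspace: "rep0 scale A \<Longrightarrow> subspace (space_at A i)"
  by (simp add: rep0_def)

lemma rep0_linear:
  "rep0 scale A \<Longrightarrow> i \<le> j \<Longrightarrow> linear_map_between scale (space_at A i) (space_at A j) (smap A i j)"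
  by (simp add: rep0_def)

lemma rep0_smap_mem: "rep0 scale A \<Longrightarrow> i \<le> j \<Longrightarrow> v \<in> space_at A i \<Longrightarrow> smap A i j v \<in> space_at A j"
  using rep0_linear unfolding linear_map_between_def by blast

lemma rep0_smap_add:
  "rep0 scale A \<Longrightarrow> i \<le> j \<Longrightarrow> u \<in> space_at A i \<Longrightarrow> v \<in> space_at A i \<Longrightarrow>
    smap A i j (u + v) = smap A i j u + smap A i j v"
  using rep0_linear unfolding linear_map_between_def by blast

lemma rep0_smap_scale:
  "rep0 scale A \<Longrightarrow> i \<le> j \<Longrightarrow> v \<in> space_at A i \<Longrightarrow> smap A i j (c *s v) = c *s smap A i j v"
  using rep0_linear unfolding linear_map_between_def by blast

lemma rep0_smap_zero: "rep0 scale A \<Longrightarrow> i \<le> j \<Longrightarrow> smap A i j 0 = 0"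
  using rep0_smap_scale[of A i j 0 0] rep0_subspace[of A i] subspace_0 by auto

lemma rep0_smap_diff:
  assumes "rep0 scale A" "i \<le> j" "u \<in> space_at A i" "v \<in> space_at A i"
  shows "smap A i j (u - v) = smap A i j u - smap A i j v"
proof -
  have "u - v \<in> space_at A i"
    using assms rep0_subspace subspace_diff by blast
  then have "smap A i j (u - v) + smap A i j v = smap A i j u"
    using rep0_smap_add[OF assms(1,2) _ assms(4), of "u - v"] by simp
  then show ?thesis
    by (simp add: algebra_simps)
qed

lemma rep0_smap_id: "rep0 scale A \<Longrightarrow> v \<in> space_at A i \<Longrightarrow> smap A i i v = v"
  by (simp add: rep0_def)

lemma rep0_smap_comp:
  "rep0 scale A \<Longrightarrow> i \<le> j \<Longrightarrow> j \<le> k \<Longrightarrow> v \<in> space_at A i \<Longrightarrow>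
    smap A j k (smap A i j v) = smap A i k v"
  by (simp add: rep0_def)

lemma rep0_finite: "rep0 scale A \<Longrightarrow> finite {i. space_at A i \<noteq> {0}}"
  by (simp add: rep0_def)

section \<open>Subrepresentations and splitting off one summand\<close>

lemma subrep_restrict:
  assumes "rep0 scale A" "subrep scale W A"
  shows "rep0 scale (A\<lparr>space_at := W\<rparr>)"
proof -
  have W: "subspace (W i)" "W i \<subseteq> space_at A i" for i
    using assms(2) by (auto simp: subrep_def)
  have "{i. W i \<noteq> {0}} \<subseteq> {i. space_at A i \<noteq> {0}}"
    using W subspace_0 by fastforce
  then have "finite {i. W i \<noteq> {0}}"
    using rep0_finite[OF assms(1)] finite_subset by blast
  moreover have "findim (W i)" for i
    using findim_subset[OF rep0_findim[OF assms(1)]] W by blast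
  moreover have "linear_map_between scale (W i) (W j) (smap A i j)" if "i \<le> j" for i j
    using linear_map_between_subset[OF rep0_linear[OF assms(1) that] W(2)] assms(2) that
    by (auto simp: subrep_def)
  moreover have "smap A i i v = v" if "v \<in> W i" for i v
    using that W(2) rep0_smap_id[OF assms(1)] by blast
  moreover have "smap A j k (smap A i j v) = smap A i k v" if "i \<le> j" "j \<le> k" "v \<in> W i" for i j k v
    using that W(2) rep0_smap_comp[OF assms(1)] by blast
  ultimately show ?thesis
    unfolding rep0_def by (simp add: findim_def)
qed

lemma subrep_trans:
  assumes "subrep scale W' (A\<lparr>space_at := W\<rparr>)" "subrep scale W A"
  shows "subrep scale W' A"
  using assms by (fastforce simp: subrep_def)

lemma subrep_zero: "rep0 scale A \<Longrightarrow> subrep scale (\<lambda>_. {0}) A"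
  using rep0_smap_zero[of A] subspace_0[OF rep0_subspace, of A]
  by (simp add: subrep_def subspace_single_0)

lemma is_direct_sum_iff:
  "is_direct_sum scale A n W \<longleftrightarrow>
    (\<forall>k<n. subrep scale (W k) A) \<and> (\<forall>i. dir_sum n (\<lambda>k. W k i) (space_at A i))"
  by (simp add: is_direct_sum_def dir_sum_def)

lemma is_direct_sum_0: "is_direct_sum scale A 0 W \<longleftrightarrow> (\<forall>i. space_at A i = {0})"
  by (simp add: is_direct_sum_iff dir_sum_0)

lemma is_direct_sum_SucI:
  assumes "is_direct_sum scale (A\<lparr>space_at := C\<rparr>) n W" "subrep scale C A" "subrep scale I A"
    and "\<And>i. complementary (C i) (I i) (space_at A i)"
  shows "is_direct_sum scale A (Suc n) (W(n := I))"
  unfolding is_direct_sum_iff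
proof (intro conjI allI impI)
  fix k assume "k < Suc n"
  then show "subrep scale ((W(n := I)) k) A"
    using assms(1,3) subrep_trans[OF _ assms(2)] by (auto simp: is_direct_sum_iff less_Suc_eq)
next
  fix i
  have "dir_sum n (\<lambda>k. W k i) (C i)"
    using assms(1) by (simp add: is_direct_sum_iff)
  then have "dir_sum n (\<lambda>k. (W(n := I)) k i) (C i)"
    by (subst dir_sum_cong[of n _ "\<lambda>k. W k i"]) simp_all
  then show "dir_sum (Suc n) (\<lambda>k. (W(n := I)) k i) (space_at A i)"
    using assms(2-4) by (intro dir_sum_SucI) (auto simp: subrep_def)
qed

lemma is_direct_sum_2I:
  assumes "rep0 scale A" "subrep scale C A" "subrep scale I A"
    and "\<And>i. complementary (C i) (I i) (space_at A i)"
  shows "\<exists>W. is_direct_sum scale A 2 W \<and> W 0 = C \<and> W 1 = I"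
proof -
  let ?C = "A\<lparr>space_at := C\<rparr>"
  have C: "rep0 scale ?C"
    using subrep_restrict assms by blast
  \<comment> \<open>The one-term decomposition of C, built from the empty decomposition of the zero
    subrepresentation. The update at 0 changes nothing; it is the form that
    \<open>is_direct_sum_SucI\<close> delivers.\<close>
  have "is_direct_sum scale ?C (Suc 0) ((\<lambda>_. C)(0 := C))"
  proof (rule is_direct_sum_SucI)
    show "subrep scale (\<lambda>_. {0}) ?C"
      by (rule subrep_zero[OF C])
    show "subrep scale C ?C"
      using assms(2) by (simp add: subrep_def)
    show "complementary {0} (C i) (space_at ?C i)" for i
      using rep0_subspace[OF C, of i] subspace_0 by (auto simp: complementary_def)
  qed (simp add: is_direct_sum_0)
  from is_direct_sum_SucI[OF this assms(2-4)] show ?thesis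
    by (intro exI[of _ "((\<lambda>_. C)(0 := C))(Suc 0 := I)"]) (simp add: numeral_2_eq_2)
qed

section \<open>The additive invariant\<close>

definition rank :: "('i, 'b) rep \<Rightarrow> 'i \<Rightarrow> 'i \<Rightarrow> nat" where
  "rank A i j = dim (smap A i j ` space_at A i)"

lemma rank_le:
  assumes "rep0 scale A" "i \<le> j"
  shows "rank A i j \<le> dim (space_at A i)"
  unfolding rank_def using dim_image_le_dim[OF rep0_findim rep0_linear] assms by blast

lemma rank_zero_source:
  assumes "rep0 scale A" "i \<le> j" "space_at A i = {0}"
  shows "rank A i j = 0"
  using rank_le[OF assms(1,2)] assms(3) by (simp add: dim_singleton_zero)

text \<open>The term at i is the nullity of the map from i to i + 1, that is, the number of bars
  ending at i. \<open>Sum_any\<close> sums over the nonzero terms, which are finitely many under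
  \<open>rep0\<close>.\<close>

definition bar_count :: "(int, 'b) rep \<Rightarrow> int" where
  "bar_count A = Sum_any (\<lambda>i. int (dim (space_at A i)) - int (rank A i (i + 1)))"

lemma bar_count_expand:
  assumes "rep0 scale A" "finite S" "{i. space_at A i \<noteq> {0}} \<subseteq> S"
  shows "bar_count A = (\<Sum>i\<in>S. int (dim (space_at A i)) - int (rank A i (i + 1)))"
  unfolding bar_count_def
proof (rule Sum_any.expand_superset[OF assms(2)], rule subsetI)
  fix i assume "i \<in> {i. int (dim (space_at A i)) - int (rank A i (i + 1)) \<noteq> 0}"
  then have "space_at A i \<noteq> {0}"
    using rank_zero_source[OF assms(1), of i "i + 1"] by (auto simp: dim_singleton_zero)
  then show "i \<in> S"
    using assms(3) by blast
qed

lemma bar_count_nonneg: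
  assumes "rep0 scale A"
  shows "bar_count A \<ge> 0"
  unfolding bar_count_expand[OF assms rep0_finite[OF assms] order_refl]
  using rank_le[OF assms] by (intro sum_nonneg) simp

lemma bar_count_zero: "(\<And>i. space_at A i = {0}) \<Longrightarrow> rep0 scale A \<Longrightarrow> bar_count A = 0"
  using bar_count_expand[of A "{}"] by simp

text \<open>At the last degree m of the support the outgoing map is zero, so the term at m is a
  positive dimension; all other terms are nonnegative.\<close>

lemma bar_count_pos:
  assumes A: "rep0 scale A" and "\<exists>i. space_at A i \<noteq> {0}"
  shows "bar_count A > 0"
proof -
  let ?S = "{i. space_at A i \<noteq> {0}}"
  have S: "finite ?S" "?S \<noteq> {}"
    using assms rep0_finite by auto
  define m where "m = Max ?S"
  have m: "m \<in> ?S"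
    using Max_in[OF S] by (simp add: m_def)
  have "m + 1 \<notin> ?S"
    using Max_ge[OF S(1), of "m + 1"] by (auto simp: m_def)
  then have "smap A m (m + 1) ` space_at A m \<subseteq> {0}"
    using rep0_smap_mem[OF A, of m "m + 1"] by auto
  then have "rank A m (m + 1) = 0"
    unfolding rank_def using dim_le_card[of _ "{}"] by simp
  then have "0 < int (dim (space_at A m)) - int (rank A m (m + 1))"
    using m dim_pos[OF rep0_findim[OF A]] by simp
  also have "\<dots> \<le> bar_count A"
    unfolding bar_count_expand[OF A S(1) order_refl]
    using rank_le[OF A] m S(1) by (intro member_le_sum) auto
  finally show ?thesis .
qed

text \<open>Dimensions add in each degree. Ranks add too, because the decomposition in degree i + 1
  makes the images of the summands a direct sum.\<close>

lemma bar_count_direct_sum: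
  assumes A: "rep0 scale A" and W: "is_direct_sum scale A n W"
  shows "bar_count A = (\<Sum>k<n. bar_count (A\<lparr>space_at := W k\<rparr>))"
proof -
  let ?S = "{i. space_at A i \<noteq> {0}}"
  have fin: "finite ?S"
    by (rule rep0_finite[OF A])
  have sub: "subrep scale (W k) A" if "k < n" for k
    using W that by (simp add: is_direct_sum_iff)
  have sumW: "dir_sum n (\<lambda>k. W k i) (space_at A i)" for i
    using W by (simp add: is_direct_sum_iff)
  have WA: "W k i \<subseteq> space_at A i" if "k < n" for k i
    using sub[OF that] by (simp add: subrep_def)
  have repW: "rep0 scale (A\<lparr>space_at := W k\<rparr>)" if "k < n" for k
    using subrep_restrict[OF A sub[OF that]] .
  have fW: "findim (W k i)" if "k < n" for k i
    using rep0_findim[OF repW[OF that], of i] by simp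
  have dims: "int (dim (space_at A i)) = (\<Sum>k<n. int (dim (W k i)))" for i
    using dim_dir_sum[OF sumW fW] by simp
  have ranks: "int (rank A i (i + 1)) = (\<Sum>k<n. int (rank (A\<lparr>space_at := W k\<rparr>) i (i + 1)))" for i
  proof -
    have "dir_sum n (\<lambda>k. smap A i (i + 1) ` W k i) (smap A i (i + 1) ` space_at A i)"
    proof (rule dir_sum_image[OF sumW WA rep0_findim[OF A] rep0_linear[OF A] sumW])
      show "smap A i (i + 1) ` W k i \<subseteq> W k (i + 1)" if "k < n" for k
        using sub[OF that] by (simp add: subrep_def)
    qed simp_all
    moreover have "findim (smap A i (i + 1) ` W k i)" if "k < n" for k
      using findim_image[OF rep0_findim rep0_linear, OF repW[OF that] repW[OF that], of i "i + 1"]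
      by simp
    ultimately show ?thesis
      using dim_dir_sum by (simp add: rank_def)
  qed
  have "bar_count A = (\<Sum>i\<in>?S. \<Sum>k<n. int (dim (W k i)) - int (rank (A\<lparr>space_at := W k\<rparr>) i (i + 1)))"
    unfolding bar_count_expand[OF A fin order_refl] dims ranks by (simp add: sum_subtractf)
  also have "\<dots> = (\<Sum>k<n. \<Sum>i\<in>?S. int (dim (W k i)) - int (rank (A\<lparr>space_at := W k\<rparr>) i (i + 1)))"
    by (rule sum.swap)
  also have "\<dots> = (\<Sum>k<n. bar_count (A\<lparr>space_at := W k\<rparr>))"
  proof (rule sum.cong[OF refl])
    fix k assume "k \<in> {..<n}"
    then have k: "k < n" by simp
    have "{i. W k i \<noteq> {0}} \<subseteq> ?S"
      using WA[OF k] fW[OF k] findim_subspace subspace_0 by fastforce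
    then show "(\<Sum>i\<in>?S. int (dim (W k i)) - int (rank (A\<lparr>space_at := W k\<rparr>) i (i + 1)))
        = bar_count (A\<lparr>space_at := W k\<rparr>)"
      using bar_count_expand[OF repW[OF k] fin] by simp
  qed
  finally show ?thesis .
qed

section \<open>Splitting off an interval\<close>

lemma hyperplane_exists:
  assumes V: "subspace V" and e: "e \<in> V" "e \<noteq> 0"
  obtains H where "subspace H" "complementary H (span {e}) V"
proof -
  obtain B where B: "{e} \<subseteq> B" "B \<subseteq> V" "independent B" "V \<subseteq> span B"
    using maximal_independent_subset_extend[of "{e}" V] e by auto
  let ?H = "span (B - {e})"
  have "e \<notin> ?H"
    using B by (auto simp: dependent_def)
  have "c *s e \<in> ?H \<Longrightarrow> c *s e = 0" for c
    using \<open>e \<notin> ?H\<close> span_scale[of "c *s e" "B - {e}" "inverse c"] by (cases "c = 0") auto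
  then have "?H \<inter> span {e} = {0}"
    by (auto simp: span_singleton span_zero intro: image_eqI[of _ _ 0])
  moreover have "span B = V"
    using B V by (metis span_minimal subset_antisym)
  moreover have "span B = {s + t |s t. s \<in> ?H \<and> t \<in> span {e}}"
    using B(1) span_Un[of "B - {e}" "{e}"] by (simp add: insert_absorb)
  ultimately show ?thesis
    using that[of ?H] by (simp add: complementary_def)
qed

text \<open>A generator of a bar of maximal length spans a direct summand: a complement consists of
  the elements that are mapped into a fixed hyperplane at the end of the bar.\<close>

lemma interval_summand:
  assumes A: "rep0 scale A" and nz: "\<exists>i. space_at A i \<noteq> {0}"
  obtains C I where "subrep scale C A" "subrep scale I A"
    "\<And>i. complementary (C i) (I i) (space_at A i)" "bar_count (A\<lparr>space_at := I\<rparr>) = 1"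
proof -
  let ?S = "{i. space_at A i \<noteq> {0}}"
  \<comment> \<open>The pairs between which the structure map is nonzero; both ends lie in the
    support, so a longest pair exists.\<close>
  define P where "P = {(b, d). b \<le> d \<and> (\<exists>v\<in>space_at A b. smap A b d v \<noteq> 0)}"
  have A0: "0 \<in> space_at A i" for i
    using rep0_subspace[OF A] subspace_0 by blast
  have "P \<subseteq> ?S \<times> ?S"
    using rep0_smap_zero[OF A] rep0_smap_mem[OF A] by (fastforce simp: P_def)
  then have finP: "finite P"
    using rep0_finite[OF A] finite_subset by blast
  obtain i where "space_at A i \<noteq> {0}"
    using nz by blast
  then have "(i, i) \<in> P"
    using rep0_smap_id[OF A] A0 by (force simp: P_def)
  then have neP: "P \<noteq> {}"
    by blast
  let ?len = "\<lambda>(b, d). d - b"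
  have "Max (?len ` P) \<in> ?len ` P"
    using finP neP by (intro Max_in) auto
  then obtain b d where bd: "(b, d) \<in> P" "d - b = Max (?len ` P)"
    by auto
  have longest: "d' - b' \<le> d - b" if "(b', d') \<in> P" for b' d'
    unfolding bd(2) using that finP by (intro Max_ge) force+
  obtain v where v: "v \<in> space_at A b" "smap A b d v \<noteq> 0" and "b \<le> d"
    using bd(1) by (auto simp: P_def)
  define w where "w i = smap A b i v" for i
  have w_mem: "w i \<in> space_at A i" if "b \<le> i" for i
    using that v(1) rep0_smap_mem[OF A] by (simp add: w_def)
  have w_smap: "smap A i j (w i) = w j" if "b \<le> i" "i \<le> j" for i j
    using that v(1) rep0_smap_comp[OF A] by (simp add: w_def)
  \<comment> \<open>Maximal length is used at both ends: v does not survive beyond d, which makes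
    \<open>I\<close> stable, and nothing from before b survives to d, which makes \<open>C i\<close>
    the whole space for i < b.\<close>
  have w_late: "w i = 0" if "d < i" for i
    using that longest[of b i] v(1) \<open>b \<le> d\<close> by (force simp: P_def w_def)
  have w_ne: "w i \<noteq> 0" if "b \<le> i" "i \<le> d" for i
    using w_smap[OF that] v(2) rep0_smap_zero[OF A that(2)] by (auto simp: w_def)
  have early: "smap A i d a = 0" if "i < b" "a \<in> space_at A i" for i a
    using that longest[of i d] \<open>b \<le> d\<close> by (force simp: P_def)
  obtain H where H: "subspace H" "complementary H (span {w d}) (space_at A d)"
    using hyperplane_exists[OF rep0_subspace[OF A] w_mem[OF \<open>b \<le> d\<close>] w_ne[OF \<open>b \<le> d\<close>]] by auto
  have H0: "0 \<in> H"
    by (rule subspace_0[OF H(1)])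
  define I where "I i = (if b \<le> i \<and> i \<le> d then span {w i} else {0})" for i
  \<comment> \<open>Beyond d the condition is vacuous, so \<open>C i\<close> is the whole space
    there, matching the zero space \<open>I i\<close>.\<close>
  define C where "C i = {a \<in> space_at A i. i \<le> d \<longrightarrow> smap A i d a \<in> H}" for i
  have image_span: "smap A i j ` span {w i} = span {w j}" if "b \<le> i" "i \<le> j" for i j
    using rep0_smap_scale[OF A that(2) w_mem[OF that(1)]] w_smap[OF that]
    by (simp add: span_singleton image_image)
  have subI: "subrep scale I A"
    unfolding subrep_def
  proof (intro conjI allI impI)
    fix i
    show "subspace (I i)"
      by (simp add: I_def subspace_single_0)
    show "I i \<subseteq> space_at A i"
      using A0 w_mem rep0_subspace[OF A] by (simp add: I_def span_minimal)
  next
    fix i j :: int assume "i \<le> j"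
    then show "smap A i j ` I i \<subseteq> I j"
      using image_span[of i j] rep0_smap_zero[OF A] w_late[of j] by (auto simp: I_def span_zero)
  qed
  have subC: "subrep scale C A"
    unfolding subrep_def
  proof (intro conjI allI impI)
    fix i
    show "subspace (C i)"
    proof (rule subspaceI)
      show "0 \<in> C i"
        using A0 H0 rep0_smap_zero[OF A] by (simp add: C_def)
      show "x + y \<in> C i" if "x \<in> C i" "y \<in> C i" for x y
        using that H(1) rep0_subspace[OF A, of i] rep0_smap_add[OF A, of i d]
        by (simp add: C_def subspace_add)
      show "c *s x \<in> C i" if "x \<in> C i" for c x
        using that H(1) rep0_subspace[OF A, of i] rep0_smap_scale[OF A, of i d]
        by (simp add: C_def subspace_scale)
    qed
    show "C i \<subseteq> space_at A i"
      by (auto simp: C_def)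
  next
    fix i j :: int assume "i \<le> j"
    then show "smap A i j ` C i \<subseteq> C j"
      using rep0_smap_mem[OF A] rep0_smap_comp[OF A] by (auto simp: C_def)
  qed
  have compl: "complementary (C i) (I i) (space_at A i)" for i
  proof (cases "b \<le> i \<and> i \<le> d")
    case False
    then have "C i = space_at A i" "I i = {0}"
      using early[of i] H0 by (auto simp: C_def I_def)
    then show ?thesis
      using A0[of i] by (auto simp: complementary_def)
  next
    case True
    then have i: "b \<le> i" "i \<le> d" by simp_all
    note w_scale = rep0_smap_scale[OF A i(2) w_mem[OF i(1)], unfolded w_smap[OF i]]
    have cw: "c *s w i \<in> space_at A i" for c
      using w_mem[OF i(1)] rep0_subspace[OF A] subspace_scale by blast
    have "C i \<inter> I i = {0}"
    proof (intro subset_antisym subsetI)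
      fix x assume x: "x \<in> C i \<inter> I i"
      then obtain c where c: "x = c *s w i"
        using True by (auto simp: I_def span_singleton)
      then have "c *s w d \<in> H \<inter> span {w d}"
        using x i w_scale by (auto simp: C_def span_singleton)
      then have "c *s w d = 0"
        using H(2) unfolding complementary_def by blast
      then show "x \<in> {0}"
        using c w_ne[OF \<open>b \<le> d\<close> order_refl] by simp
    qed (use A0 H0 rep0_smap_zero[OF A] in \<open>auto simp: C_def I_def span_zero\<close>)
    moreover have "space_at A i = {s + t |s t. s \<in> C i \<and> t \<in> I i}"
    proof (intro subset_antisym subsetI)
      fix a assume a: "a \<in> space_at A i"
      then have "smap A i d a \<in> space_at A d"
        using rep0_smap_mem[OF A] i by blast
      \<comment> \<open>The coefficient c is read off in degree d; subtracting c times
        \<open>w i\<close> leaves an element whose image in degree d is the H-component h.\<close>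
      then obtain h c where h: "h \<in> H" "smap A i d a = h + c *s w d"
        using H(2) by (auto simp: complementary_def span_singleton)
      then have "smap A i d (a - c *s w i) = h"
        using rep0_smap_diff[OF A i(2) a cw] w_scale by simp
      then have "a - c *s w i \<in> C i"
        using h a cw rep0_subspace[OF A, of i] by (simp add: C_def subspace_diff)
      moreover have "c *s w i \<in> I i"
        using True by (simp add: I_def span_scale span_base)
      moreover have "a = (a - c *s w i) + c *s w i"
        by simp
      ultimately show "a \<in> {s + t |s t. s \<in> C i \<and> t \<in> I i}"
        by blast
    next
      fix a assume "a \<in> {s + t |s t. s \<in> C i \<and> t \<in> I i}"
      moreover have "C i \<subseteq> space_at A i" "I i \<subseteq> space_at A i"
        using subC subI by (auto simp: subrep_def)
      ultimately show "a \<in> space_at A i"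
        using rep0_subspace[OF A, of i] subspace_add by blast
    qed
    ultimately show ?thesis
      by (simp add: complementary_def)
  qed
  \<comment> \<open>Along the bar each dimension 1 is cancelled by the rank 1 of the outgoing map,
    except at d, where the next generator is 0.\<close>
  have "bar_count (A\<lparr>space_at := I\<rparr>) = Sum_any (\<lambda>i. if i = d then 1 else 0)"
    unfolding bar_count_def
  proof (rule arg_cong[where f = Sum_any], rule ext)
    fix i
    let ?J = "A\<lparr>space_at := I\<rparr>"
    show "int (dim (space_at ?J i)) - int (rank ?J i (i + 1)) = (if i = d then 1 else 0)"
    proof (cases "b \<le> i \<and> i \<le> d")
      case True
      then have "dim (I i) = 1"
        using w_ne dim_span_singleton by (simp add: I_def)
      moreover have "rank ?J i (i + 1) = dim (span {w (i + 1)})"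
        using True image_span[of i "i + 1"] by (simp add: rank_def I_def)
      moreover have "dim (span {w (i + 1)}) = (if i = d then 0 else 1)"
        using True w_ne[of "i + 1"] w_late[of "i + 1"] dim_span_singleton
        by (auto simp: dim_singleton_zero)
      ultimately show ?thesis
        by simp
    next
      case False
      then show ?thesis
        using rep0_smap_zero[OF A, of i "i + 1"] \<open>b \<le> d\<close>
        by (auto simp: rank_def I_def dim_singleton_zero)
    qed
  qed
  then show ?thesis
    using that[OF subC subI compl] by simp
qed

section \<open>The number of indecomposable summands\<close>

lemma bar_count_indecomposable:
  assumes A: "rep0 scale A" and ind: "indecomposable scale A"
  shows "bar_count A = 1"
proof -
  obtain C I where CI: "subrep scale C A" "subrep scale I A"
    "\<And>i. complementary (C i) (I i) (space_at A i)" "bar_count (A\<lparr>space_at := I\<rparr>) = 1"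
    using interval_summand[OF A] ind unfolding indecomposable_def by metis
  obtain W where W: "is_direct_sum scale A 2 W" "W 0 = C" "W 1 = I"
    using is_direct_sum_2I[OF A CI(1-3)] by blast
  have "\<not> (\<forall>i. I i = {0})"
    using bar_count_zero[of "A\<lparr>space_at := I\<rparr>"] CI(4) subrep_restrict[OF A CI(2)] by auto
  \<comment> \<open>Since \<open>I\<close> is nonzero, the other summand must vanish, and A is the
    interval.\<close>
  then have "\<forall>i. C i = {0}"
    using ind W by (auto simp: indecomposable_def)
  then have "bar_count (A\<lparr>space_at := C\<rparr>) = 0"
    using bar_count_zero subrep_restrict[OF A CI(1)] by simp
  moreover have "{..<2} = {0, 1 :: nat}"
    by auto
  ultimately show ?thesis
    using bar_count_direct_sum[OF A W(1)] W CI(4) by simp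
qed

text \<open>In a splitting the two counts are nonnegative integers with sum 1, so one of them is 0,
  which only the zero representation attains.\<close>

lemma indecomposable_if_bar_count:
  assumes A: "rep0 scale A" and 1: "bar_count A = 1"
  shows "indecomposable scale A"
  unfolding indecomposable_def
proof (intro conjI allI impI)
  show "\<exists>i. space_at A i \<noteq> {0}"
    using bar_count_zero[OF _ A] 1 by auto
next
  fix W assume W: "is_direct_sum scale A 2 W"
  have rep: "rep0 scale (A\<lparr>space_at := W k\<rparr>)" if "k < 2" for k
    using that W subrep_restrict[OF A] by (simp add: is_direct_sum_iff)
  have "{..<2} = {0, 1 :: nat}"
    by auto
  then have "bar_count (A\<lparr>space_at := W 0\<rparr>) + bar_count (A\<lparr>space_at := W 1\<rparr>) = 1"
    using bar_count_direct_sum[OF A W] 1 by simp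
  then show "(\<forall>i. W 0 i = {0}) \<or> (\<forall>i. W 1 i = {0})"
    using bar_count_pos[OF rep, of 0] bar_count_pos[OF rep, of 1] by force
qed

lemma indecomposable_decomposition:
  assumes "rep0 scale A" "bar_count A = int n"
  shows "\<exists>W. is_direct_sum scale A n W \<and> (\<forall>k<n. indecomposable scale (A\<lparr>space_at := W k\<rparr>))"
  using assms
proof (induction n arbitrary: A)
  case 0
  then have "\<forall>i. space_at A i = {0}"
    using bar_count_pos[OF 0(1)] by force
  then show ?case
    by (simp add: is_direct_sum_0)
next
  case (Suc n)
  have "\<exists>i. space_at A i \<noteq> {0}"
    using bar_count_zero[OF _ Suc.prems(1)] Suc.prems(2) by auto
  then obtain C I where CI: "subrep scale C A" "subrep scale I A"
    "\<And>i. complementary (C i) (I i) (space_at A i)" "bar_count (A\<lparr>space_at := I\<rparr>) = 1"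
    using interval_summand[OF Suc.prems(1)] by metis
  note C = subrep_restrict[OF Suc.prems(1) CI(1)] and I = subrep_restrict[OF Suc.prems(1) CI(2)]
  obtain W2 where W2: "is_direct_sum scale A 2 W2" "W2 0 = C" "W2 1 = I"
    using is_direct_sum_2I[OF Suc.prems(1) CI(1-3)] by blast
  have "{..<2} = {0, 1 :: nat}"
    by auto
  then have "bar_count (A\<lparr>space_at := C\<rparr>) = int n"
    using bar_count_direct_sum[OF Suc.prems(1) W2(1)] W2 CI(4) Suc.prems(2) by simp
  then obtain W where W: "is_direct_sum scale (A\<lparr>space_at := C\<rparr>) n W"
    "\<And>k. k < n \<Longrightarrow> indecomposable scale (A\<lparr>space_at := W k\<rparr>)"
    using Suc.IH[OF C] by auto
  have "is_direct_sum scale A (Suc n) (W(n := I))"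
    by (rule is_direct_sum_SucI[OF W(1) CI(1-3)])
  moreover have "indecomposable scale (A\<lparr>space_at := (W(n := I)) k\<rparr>)" if "k < Suc n" for k
    using that W(2) indecomposable_if_bar_count[OF I CI(4)] by (auto simp: less_Suc_eq)
  ultimately show ?case
    by blast
qed

text \<open>Any decomposition into n indecomposables has total count n by additivity, so n is
  determined by A; splitting off intervals one at a time provides such a decomposition.\<close>

lemma count1_eq_bar_count:
  assumes A: "rep0 scale A"
  shows "int (count1 scale A) = bar_count A"
proof -
  let ?D = "\<lambda>n. \<exists>W. is_direct_sum scale A n W \<and> (\<forall>k<n. indecomposable scale (A\<lparr>space_at := W k\<rparr>))"
  have "?D (nat (bar_count A))"
    using indecomposable_decomposition[OF A] bar_count_nonneg[OF A] by simp
  moreover have "n = nat (bar_count A)" if "?D n" for n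
  proof -
    obtain W where W: "is_direct_sum scale A n W"
      "\<And>k. k < n \<Longrightarrow> indecomposable scale (A\<lparr>space_at := W k\<rparr>)"
      using \<open>?D n\<close> by blast
    have "bar_count (A\<lparr>space_at := W k\<rparr>) = 1" if "k < n" for k
      using bar_count_indecomposable[OF subrep_restrict[OF A]] W that
      by (simp add: is_direct_sum_iff)
    then show ?thesis
      using bar_count_direct_sum[OF A W(1)] by simp
  qed
  ultimately have "count1 scale A = nat (bar_count A)"
    unfolding count1_def by (rule the_equality)
  then show ?thesis
    using bar_count_nonneg[OF A] by simp
qed

section \<open>Subadditivity of the nullity along a chain\<close>

lemma nullity_comp:
  assumes A: "rep0 scale A" and ab: "a \<le> b" "b \<le> c"
  shows "int (dim (space_at A a)) - int (rank A a c) \<le>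
    (int (dim (space_at A a)) - int (rank A a b)) + (int (dim (space_at A b)) - int (rank A b c))"
proof -
  \<comment> \<open>The nullity of the composite exceeds that of the first map by the nullity of the
    second map on this image.\<close>
  let ?W = "smap A a b ` space_at A a"
  have "smap A b c ` ?W = smap A a c ` space_at A a"
    using rep0_smap_comp[OF A ab] by (auto simp: image_image)
  moreover have "?W \<subseteq> space_at A b"
    using rep0_smap_mem[OF A ab(1)] by blast
  moreover have "subspace ?W"
    using findim_image[OF rep0_findim rep0_linear] A ab(1) findim_subspace by blast
  ultimately show ?thesis
    using nullity_mono[OF rep0_findim[OF A] rep0_linear[OF A ab(2)], of ?W]
    by (simp add: rank_def)
qed

lemma nullity_le_sum:
  fixes A :: "(int, 'b) rep"
  assumes A: "rep0 scale A" and "a \<le> c"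
  shows "int (dim (space_at A a)) - int (rank A a c) \<le>
    (\<Sum>s\<in>{a..<c}. int (dim (space_at A s)) - int (rank A s (s + 1)))"
  using assms(2)
proof (induction c rule: int_ge_induct)
  case base
  have "smap A a a ` space_at A a = space_at A a"
    using rep0_smap_id[OF A] by auto
  then show ?case
    by (simp add: rank_def)
next
  case (step c)
  have "{a..<c + 1} = insert c {a..<c}"
    using step.hyps by auto
  then show ?case
    using nullity_comp[OF A step.hyps, of "c + 1"] step.IH by simp
qed

text \<open>The coarse term at i is bounded by the fine terms over the half-open interval from
  \<open>h i\<close> to \<open>h (i + 1)\<close>. These intervals are disjoint, and the fine terms
  outside them are nonnegative.\<close>

lemma bar_count_pullback_le:
  fixes A :: "(int, 'b) rep"
  assumes A: "rep0 scale A" and h: "strict_mono h"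
  shows "bar_count (pullback h A) \<le> bar_count A"
proof -
  let ?n = "\<lambda>s. int (dim (space_at A s)) - int (rank A s (s + 1))"
  let ?B = "pullback h A"
  let ?S = "{i. space_at ?B i \<noteq> {0}}"
  let ?J = "\<lambda>i. {h i..<h (i + 1)}"
  \<comment> \<open>The intervals may contain degrees where A vanishes, so the common index set
    needs both parts.\<close>
  let ?T = "{i. space_at A i \<noteq> {0}} \<union> (\<Union>i\<in>?S. ?J i)"
  have hmono: "h i \<le> h j" if "i \<le> j" for i j
    using h that by (simp add: strict_mono_less_eq)
  have B: "rep0 scale ?B"
    using rep0_pullback[OF A strict_mono_mono[OF h] strict_mono_imp_inj_on[OF h]] .
  have fin: "finite ?S" "finite ?T"
    using rep0_finite[OF A] rep0_finite[OF B] by auto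
  have "?J i \<inter> ?J j = {}" if "i < j" for i j
    using hmono[of "i + 1" j] that by auto
  then have disj: "?J i \<inter> ?J j = {}" if "i \<noteq> j" for i j
    using that by (metis inf_commute linorder_less_linear)
  have "bar_count ?B = (\<Sum>i\<in>?S. int (dim (space_at A (h i))) - int (rank A (h i) (h (i + 1))))"
    unfolding bar_count_expand[OF B fin(1) order_refl] by (simp add: pullback_def rank_def)
  also have "\<dots> \<le> (\<Sum>i\<in>?S. \<Sum>s\<in>?J i. ?n s)"
    using hmono by (intro sum_mono nullity_le_sum[OF A]) simp
  also have "\<dots> = (\<Sum>s\<in>(\<Union>i\<in>?S. ?J i). ?n s)"
    using fin(1) disj by (intro sum.UNION_disjoint[symmetric]) simp_all
  also have "\<dots> \<le> (\<Sum>s\<in>?T. ?n s)"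
    using fin(2) rank_le[OF A] by (intro sum_mono2) auto
  also have "\<dots> = bar_count A"
    by (rule bar_count_expand[OF A fin(2), symmetric]) simp
  finally show ?thesis .
qed

end

section \<open>Refining a chain to a lattice path\<close>

text \<open>Each step raises h by at least 1, so it suffices to search the indices within \<bar>s -
  h 0\<bar> of 0 for the largest one with \<open>h i \<le> s\<close>.\<close>

lemma strict_mono_int_bracket:
  fixes h :: "int \<Rightarrow> int"
  assumes h: "strict_mono h"
  obtains i where "h i \<le> s" "s < h (i + 1)"
proof -
  have step: "h i + 1 \<le> h (i + 1)" for i
    using strict_monoD[OF h, of i "i + 1"] by simp
  have up: "h 0 + int n \<le> h (int n)" for n
  proof (induction n)
    case (Suc n)
    then show ?case
      using step[of "int n"] by (simp add: add.commute)
  qed simp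
  have down: "h (- int n) \<le> h 0 - int n" for n
  proof (induction n)
    case (Suc n)
    then show ?case
      using step[of "- int (Suc n)"] by simp
  qed simp
  let ?S = "{i. h i \<le> s} \<inter> {- int (nat \<bar>s - h 0\<bar>) .. int (nat \<bar>s - h 0\<bar>)}"
  have "- int (nat \<bar>s - h 0\<bar>) \<in> ?S"
    using down[of "nat \<bar>s - h 0\<bar>"] by simp
  then have S: "finite ?S" "?S \<noteq> {}"
    by blast+
  define m where "m = Max ?S"
  have m: "m \<in> ?S"
    using Max_in[OF S] by (simp add: m_def)
  have "s < h (m + 1)"
  proof (rule ccontr)
    assume "\<not> s < h (m + 1)"
    then have le: "h (m + 1) \<le> s" by simp
    have "m + 1 \<notin> ?S"
      using Max_ge[OF S(1), of "m + 1"] by (auto simp: m_def)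
    then have "m = int (nat \<bar>s - h 0\<bar>)"
      using le m by auto
    then show False
      using up[of "nat \<bar>s - h 0\<bar>"] step[of m] le by simp
  qed
  then show ?thesis
    using that[of m] m by simp
qed

text \<open>The path is parametrized by the coordinate sum s, with g as its first coordinate. Then s
  - g s is the second one, and the condition on g says that each step goes one unit up or right. The
  chain point \<open>l i\<close> is met at time \<open>h i\<close>, its coordinate sum.\<close>

lemma lattice_path_through_chain:
  fixes l :: "int \<Rightarrow> int \<times> int"
  assumes "inj l" "mono l"
  obtains g h :: "int \<Rightarrow> int" where "strict_mono h" "\<And>s. g (s + 1) = g s \<or> g (s + 1) = g s + 1"
    "\<And>i. l i = (g (h i), h i - g (h i))"
proof -
  define h where "h i = fst (l i) + snd (l i)" for i
  have le: "fst (l i) \<le> fst (l j) \<and> snd (l i) \<le> snd (l j)" if "i \<le> j" for i j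
    using monoD[OF assms(2) that] by (simp add: less_eq_prod_def)
  have h: "strict_mono h"
  proof (rule strict_monoI)
    fix i j :: int assume ij: "i < j"
    then have "l i \<noteq> l j"
      using injD[OF assms(1)] by blast
    then show "h i < h j"
      using le[of i j] ij by (auto simp: h_def prod_eq_iff)
  qed
  have less: "h i < h j \<longleftrightarrow> i < j" and le': "h i \<le> h j \<longleftrightarrow> i \<le> j" for i j
    using h by (simp_all add: strict_mono_less strict_mono_less_eq)
  have "\<exists>r. \<forall>s. h (r s) \<le> s \<and> s < h (r s + 1)"
    using strict_mono_int_bracket[OF h] by (intro choice) blast
  then obtain r where r: "\<And>s. h (r s) \<le> s" "\<And>s. s < h (r s + 1)"
    by blast
  have r_eq: "r s = i" if "h i \<le> s" "s < h (i + 1)" for i s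
  proof -
    have "h i < h (r s + 1)" "h (r s) < h (i + 1)"
      using that r[of s] by linarith+
    then show ?thesis
      by (simp add: less)
  qed
  \<comment> \<open>Here \<open>r s\<close> is the chain point last passed. From it the path runs
    right until the first coordinate of the next chain point is reached (the minimum), then
    up.\<close>
  define g where "g s = min (fst (l (r s)) + (s - h (r s))) (fst (l (r s + 1)))" for s
  have gh: "g (h i) = fst (l i)" for i
  proof -
    have "r (h i) = i"
      by (rule r_eq) (simp_all add: less)
    then show ?thesis
      using le[of i "i + 1"] by (simp add: g_def)
  qed
  have "g (s + 1) = g s \<or> g (s + 1) = g s + 1" for s
  proof (cases "s + 1 < h (r s + 1)")
    case True
    then have "r (s + 1) = r s"
      using r(1)[of s] by (intro r_eq) auto
    then show ?thesis
      by (auto simp: g_def min_def)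
  next
    case False
    then have "s + 1 = h (r s + 1)"
      using r(2)[of s] by simp
    \<comment> \<open>The last step into a chain point: it is vertical if the second coordinate has
      to grow at all, and horizontal otherwise.\<close>
    then have "g (s + 1) = fst (l (r s + 1))" "s = h (r s + 1) - 1"
      using gh by simp_all
    then show ?thesis
      using le[of "r s" "r s + 1"] by (auto simp: g_def h_def)
  qed
  moreover have "l i = (g (h i), h i - g (h i))" for i
    using gh[of i] by (simp add: h_def prod_eq_iff)
  ultimately show ?thesis
    using that[of h g] h by blast
qed

lemma lattice_path_embedding:
  fixes g :: "int \<Rightarrow> int"
  assumes g: "\<And>s. g (s + 1) = g s \<or> g (s + 1) = g s + 1"
  shows "mono (\<lambda>s. (g s, s - g s))" "inj (\<lambda>s. (g s, s - g s))"
proof -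
  let ?P = "\<lambda>s. (g s, s - g s)"
  have "?P i \<le> ?P j" if "i \<le> j" for i j
    using that
  proof (induction j rule: int_ge_induct)
    case (step j)
    then show ?case
      using g[of j] by (auto simp: less_eq_prod_def)
  qed simp
  then show "mono ?P"
    by (rule monoI)
  show "inj ?P"
    by (auto simp: inj_on_def)
qed

section \<open>The two-parameter count along a lattice path\<close>

text \<open>Only points of F whose translate by d is also in F contribute to either side. This moves
  the rank of an edge or square from one of its corners to another.\<close>

lemma sum_shift:
  fixes f :: "'a::ab_group_add \<Rightarrow> 'b::comm_monoid_add"
  assumes F: "finite F" and f: "\<And>p. p \<notin> F \<or> p + d \<notin> F \<Longrightarrow> f p = 0"
  shows "(\<Sum>p\<in>F. f (p - d)) = (\<Sum>p\<in>F. f p)"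
proof -
  let ?G = "{p \<in> F. p + d \<in> F}"
  have "(\<Sum>p\<in>F. f (p - d)) = (\<Sum>p\<in>(\<lambda>p. p + d) ` ?G. f (p - d))"
  proof (rule sum.mono_neutral_right[OF F])
    show "\<forall>p\<in>F - (\<lambda>p. p + d) ` ?G. f (p - d) = 0"
    proof
      fix p assume p: "p \<in> F - (\<lambda>p. p + d) ` ?G"
      then have "p - d \<notin> ?G"
        using imageI[of "p - d" ?G "\<lambda>p. p + d"] by auto
      then show "f (p - d) = 0"
        using f[of "p - d"] by auto
    qed
  qed auto
  also have "\<dots> = (\<Sum>p\<in>?G. f p)"
    by (subst sum.reindex) (auto simp: inj_on_def)
  also have "\<dots> = (\<Sum>p\<in>F. f p)"
    using f by (intro sum.mono_neutral_left[OF F]) auto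
  finally show ?thesis .
qed

context ambient_space
begin

lemma total_dim_expand:
  assumes "finite F" "{i. W i \<noteq> {0}} \<subseteq> F"
  shows "int (total_dim scale W) = (\<Sum>i\<in>F. int (dim (W i)))"
proof -
  have "total_dim scale W = (\<Sum>i\<in>F. dim (W i))"
    unfolding total_dim_def using assms dim_singleton_zero
    by (intro sum.mono_neutral_left) auto
  then show ?thesis
    by simp
qed

text \<open>The nullity on the whole space at j minus the nullity on the image from i. When i, j, k
  go around two sides of a unit square, \<open>rank M i k\<close> is the rank of its
  diagonal.\<close>

lemma nonneg_square:
  assumes M: "rep0 scale M" and "i \<le> j" "j \<le> k"
  shows "0 \<le> int (dim (space_at M j)) - int (rank M j k) - int (rank M i j) + int (rank M i k)"
  using nullity_comp[OF assms] by simp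

text \<open>The graded pieces of xM, yM and xyM sit at the ends of the maps; this rewrites the count
  by starting points. F contains the support and its translates, so the shift loses nothing. By
  functoriality xyM is the image of the diagonal maps.\<close>

lemma count2_expand:
  assumes M: "rep0 scale M" and F: "finite F"
    and supp: "\<And>p. space_at M p \<noteq> {0} \<Longrightarrow> {p, p + (1,0), p + (0,1), p + (1,1)} \<subseteq> F"
  shows "count2 scale M = (\<Sum>p\<in>F. int (dim (space_at M p)) - int (rank M p (p + (1,0)))
    - int (rank M p (p + (0,1))) + int (rank M p (p + (1,1))))"
proof -
  have le: "p \<le> p + (1,0)" "p \<le> p + (0,1)" "p \<le> p + (1,1)" for p :: "int \<times> int"
    by (simp_all add: less_eq_prod_def)
  have shift: "int (total_dim scale (\<lambda>p. smap M (p - d) p ` space_at M (p - d))) =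
      (\<Sum>p\<in>F. int (rank M p (p + d)))" if d: "d \<in> {(1,0), (0,1), (1,1)}" for d
  proof -
    have led: "p \<le> p + d" for p
      using d le[of p] by auto
    have "{p. smap M (p - d) p ` space_at M (p - d) \<noteq> {0}} \<subseteq> F"
    proof
      fix p assume p: "p \<in> {p. smap M (p - d) p ` space_at M (p - d) \<noteq> {0}}"
      have "smap M (p - d) p 0 = 0"
        using led[of "p - d"] by (intro rep0_smap_zero[OF M]) simp
      then have "space_at M (p - d) \<noteq> {0}"
        using p by force
      then show "p \<in> F"
        using supp[of "p - d"] d by auto
    qed
    then have "int (total_dim scale (\<lambda>p. smap M (p - d) p ` space_at M (p - d))) =
        (\<Sum>p\<in>F. int (rank M (p - d) (p - d + d)))"
      using total_dim_expand[OF F, of "\<lambda>p. smap M (p - d) p ` space_at M (p - d)"]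
      by (simp add: rank_def)
    also have "\<dots> = (\<Sum>p\<in>F. int (rank M p (p + d)))"
    proof (rule sum_shift[OF F])
      fix p assume "p \<notin> F \<or> p + d \<notin> F"
      then have "space_at M p = {0}"
        using supp[of p] d by auto
      then show "int (rank M p (p + d)) = 0"
        using rank_zero_source[OF M led] by simp
    qed
    finally show ?thesis .
  qed
  have "shift_image (1,0) M (shift_image (0,1) M (space_at M)) =
      (\<lambda>p. smap M (p - (1,1)) p ` space_at M (p - (1,1)))"
  proof
    fix p :: "int \<times> int"
    have p: "p - (1,0) - (0,1) = p - (1,1)"
      by (simp add: prod_eq_iff)
    have ineqs: "p - (1,1) \<le> p - (1,0)" "p - (1,0) \<le> p"
      by (simp_all add: less_eq_prod_def)
    show "shift_image (1,0) M (shift_image (0,1) M (space_at M)) p =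
        smap M (p - (1,1)) p ` space_at M (p - (1,1))"
      using rep0_smap_comp[OF M ineqs] by (simp add: shift_image_def p image_image)
  qed
  moreover have "int (total_dim scale (space_at M)) = (\<Sum>p\<in>F. int (dim (space_at M p)))"
    using supp by (intro total_dim_expand[OF F]) auto
  ultimately show ?thesis
    using shift[of "(1,0)"] shift[of "(0,1)"] shift[of "(1,1)"]
    by (simp add: count2_def shift_image_def[of _ M "space_at M"] sum_subtractf sum.distrib)
qed

text \<open>\<open>U\<close> and \<open>L\<close> indicate the points above and below the path. Above the path a point is
  grouped with the horizontal edge starting there and the vertical edge ending there, below the
  path conversely.\<close>

lemma bar_count_lattice_path_le:
  assumes M: "rep0 scale M" and g: "\<And>s. g (s + 1) = g s \<or> g (s + 1) = g s + 1"
  shows "bar_count (pullback (\<lambda>s. (g s, s - g s)) M) \<le> count2 scale M"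
proof -
  define P where "P s = (g s, s - g s)" for s
  define D where "D p = int (dim (space_at M p))" for p :: "int \<times> int"
  define X where "X p = int (rank M p (p + (1,0)))" for p :: "int \<times> int"
  define Y where "Y p = int (rank M p (p + (0,1)))" for p :: "int \<times> int"
  define Q where "Q p = int (rank M p (p + (1,1)))" for p :: "int \<times> int"
  define U where "U p = (if fst p < g (fst p + snd p) then 1 else 0 :: int)" for p :: "int \<times> int"
  define L where "L p = (if fst p > g (fst p + snd p) then 1 else 0 :: int)" for p :: "int \<times> int"
  \<comment> \<open>\<open>R\<close> is the rank of the edge by which the path leaves
    \<open>P s\<close>, and \<open>N\<close> is the term of \<open>bar_count\<close> carried to that
    point and extended by 0 off the path.\<close>
  define R where "R s = (if g (s + 1) = g s then Y (P s) else X (P s))" for s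
  define N where "N p = (if fst p = g (fst p + snd p) then D p - R (fst p + snd p) else 0)" for p :: "int \<times> int"
  let ?S = "{p. space_at M p \<noteq> {0}}"
  define F where "F = (\<Union>p\<in>?S. {p, p + (1,0), p + (0,1), p + (1,1)})"
  have F: "finite F"
    using rep0_finite[OF M] by (simp add: F_def)
  have supp: "{p, p + (1,0), p + (0,1), p + (1,1)} \<subseteq> F" if "space_at M p \<noteq> {0}" for p
    using that unfolding F_def by blast
  have le: "p \<le> p + (1,0)" "p \<le> p + (0,1)" "p \<le> p + (1,1)" for p :: "int \<times> int"
    by (simp_all add: less_eq_prod_def)
  have zero: "X p = 0 \<and> Y p = 0 \<and> Q p = 0" if "p \<notin> F \<or> p + (1,0) \<notin> F \<or> p + (0,1) \<notin> F" for p
  proof -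
    have "space_at M p = {0}"
      using that supp[of p] by auto
    then show ?thesis
      using rank_zero_source[OF M le(1)] rank_zero_source[OF M le(2)] rank_zero_source[OF M le(3)]
      by (simp add: X_def Y_def Q_def)
  qed
  have P: "mono P" "inj P"
    unfolding P_def[abs_def] by (fact lattice_path_embedding[where g = g, OF g])+
  have "count2 scale M = (\<Sum>p\<in>F. D p - X p - Y p + Q p)"
    unfolding D_def X_def Y_def Q_def by (rule count2_expand[OF M F supp])
  \<comment> \<open>An identity at each p. If p is on the path and the path leaves it to the right,
    p + (0,1) is above the path and takes the vertical edge and the square; if it leaves upwards, p
    + (1,0) is below and takes the horizontal edge and the square.\<close>
  also have "\<dots> = (\<Sum>p\<in>F. (U p * D p - U p * X p - U (p + (0,1)) * Y p + U (p + (0,1)) * Q p)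
      + (L p * D p - L p * Y p - L (p + (1,0)) * X p + L (p + (1,0)) * Q p) + N p)"
  proof (rule sum.cong[OF refl])
    fix p :: "int \<times> int"
    obtain a b where p: "p = (a, b)"
      by force
    have s: "a + 1 + b = a + b + 1" "a + (b + 1) = a + b + 1"
      by simp_all
    have "N p = (if a = g (a + b) then D p - (if g (a + b + 1) = g (a + b) then Y p else X p) else 0)"
      by (auto simp: N_def R_def P_def p)
    then show "D p - X p - Y p + Q p =
      (U p * D p - U p * X p - U (p + (0,1)) * Y p + U (p + (0,1)) * Q p)
      + (L p * D p - L p * Y p - L (p + (1,0)) * X p + L (p + (1,0)) * Q p) + N p"
      using g[of "a + b"]
      by (cases a "g (a + b)" rule: linorder_cases) (auto simp: U_def L_def p s)
  qed
  \<comment> \<open>Edges and squares charged to p + (0,1) or p + (1,0) are reindexed by that point,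
    so that each off-path point collects its own bracket.\<close>
  also have "\<dots> = (\<Sum>p\<in>F. U p * (D p - X p - Y (p - (0,1)) + Q (p - (0,1))))
      + (\<Sum>p\<in>F. L p * (D p - Y p - X (p - (1,0)) + Q (p - (1,0)))) + (\<Sum>p\<in>F. N p)"
  proof -
    have above: "(\<Sum>p\<in>F. U (p - (0,1) + (0,1)) * f (p - (0,1))) = (\<Sum>p\<in>F. U (p + (0,1)) * f p)"
      if "f = Y \<or> f = Q" for f
    proof (rule sum_shift[OF F])
      show "U (p + (0,1)) * f p = 0" if "p \<notin> F \<or> p + (0,1) \<notin> F" for p
        using zero[of p] that \<open>f = Y \<or> f = Q\<close> by auto
    qed
    have below: "(\<Sum>p\<in>F. L (p - (1,0) + (1,0)) * f (p - (1,0))) = (\<Sum>p\<in>F. L (p + (1,0)) * f p)"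
      if "f = X \<or> f = Q" for f
    proof (rule sum_shift[OF F])
      show "L (p + (1,0)) * f p = 0" if "p \<notin> F \<or> p + (1,0) \<notin> F" for p
        using zero[of p] that \<open>f = X \<or> f = Q\<close> by auto
    qed
    show ?thesis
      using above[of Y] above[of Q] below[of X] below[of Q]
      by (simp add: sum.distrib sum_subtractf distrib_left right_diff_distrib)
  qed
  also have "\<dots> \<ge> (\<Sum>p\<in>F. N p)"
  proof -
    have diag: "p - (0,1) + (1,1) = p + (1,0)" "p - (1,0) + (1,1) = p + (0,1)" for p :: "int \<times> int"
      by (simp_all add: prod_eq_iff)
    \<comment> \<open>The two sides up into p and right out of p; the square they bound starts at p
      - (0,1).\<close>
    have "0 \<le> D p - X p - Y (p - (0,1)) + Q (p - (0,1))" for p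
      using nonneg_square[OF M, of "p - (0,1)" p "p + (1,0)"] le[of p] le[of "p - (0,1)"]
      by (simp add: D_def X_def Y_def Q_def diag)
    moreover have "0 \<le> D p - Y p - X (p - (1,0)) + Q (p - (1,0))" for p
      using nonneg_square[OF M, of "p - (1,0)" p "p + (0,1)"] le[of p] le[of "p - (1,0)"]
      by (simp add: D_def X_def Y_def Q_def diag)
    ultimately have "0 \<le> (\<Sum>p\<in>F. U p * (D p - X p - Y (p - (0,1)) + Q (p - (0,1))))"
      "0 \<le> (\<Sum>p\<in>F. L p * (D p - Y p - X (p - (1,0)) + Q (p - (1,0))))"
      unfolding U_def L_def by (auto intro!: sum_nonneg simp del: diff_ge_0_iff_ge)
    then show ?thesis
      by simp
  qed
  also have "(\<Sum>p\<in>F. N p) = bar_count (pullback P M)"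
  proof -
    let ?B = "pullback P M"
    have B: "rep0 scale ?B"
      by (rule rep0_pullback[OF M P])
    have "bar_count ?B = (\<Sum>s\<in>P -` F. D (P s) - R s)"
    proof -
      have "finite (P -` F)"
        using F P(2) by (rule finite_vimageI)
      moreover have "{s. space_at ?B s \<noteq> {0}} \<subseteq> P -` F"
        using supp[of "P s" for s] by (auto simp: pullback_def simp del: split_paired_All)
      moreover have "int (rank ?B s (s + 1)) = R s" for s
      proof -
        have "P (s + 1) = (if g (s + 1) = g s then P s + (0,1) else P s + (1,0))"
          using g[of s] by (auto simp: P_def)
        then show ?thesis
          by (simp add: R_def X_def Y_def rank_def pullback_def)
      qed
      ultimately show ?thesis
        using bar_count_expand[OF B] by (simp add: D_def pullback_def)
    qed
    also have "\<dots> = (\<Sum>s\<in>P -` F. N (P s))"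
      by (simp add: N_def P_def)
    also have "\<dots> = (\<Sum>p\<in>P ` (P -` F). N p)"
      by (rule sum.reindex_cong[OF inj_on_subset[OF P(2)], symmetric]) simp_all
    also have "\<dots> = (\<Sum>p\<in>F. N p)"
    proof (rule sum.mono_neutral_left[OF F])
      show "\<forall>p\<in>F - P ` (P -` F). N p = 0"
      proof
        fix p assume "p \<in> F - P ` (P -` F)"
        \<comment> \<open>A point is on the path exactly when it is the path point with its own
          coordinate sum.\<close>
        then have "p \<noteq> P (fst p + snd p)"
          by (metis DiffD1 DiffD2 image_eqI vimageI)
        then show "N p = 0"
          by (auto simp: N_def P_def prod_eq_iff)
      qed
    qed auto
    finally show ?thesis ..
  qed
  finally show ?thesis
    by (simp add: P_def[abs_def])
qed

end

theorem theoremB: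
  fixes scale :: "'k::field \<Rightarrow> 'v::ab_group_add \<Rightarrow> 'v"
    and M :: "(int \<times> int, 'v) rep"
    and l :: "int \<Rightarrow> int \<times> int"
  assumes "vector_space scale"
    and "inj l"
    and "mono l"
    and "rep0 scale M"
  shows "count2 scale M \<ge> int (count1 scale (pullback l M))"
proof -
  interpret ambient_space scale
    using assms(1) by (rule ambient_space.intro)
  obtain g h where h: "strict_mono h" and g: "\<And>s. g (s + 1) = g s \<or> g (s + 1) = g s + 1"
    and l: "\<And>i. l i = (g (h i), h i - g (h i))"
    using lattice_path_through_chain[OF assms(2,3)] by metis
  let ?P = "\<lambda>s. (g s, s - g s)"
  have P: "rep0 scale (pullback ?P M)"
    by (rule rep0_pullback[OF assms(4) lattice_path_embedding[where g = g, OF g]])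
  have "pullback l M = pullback h (pullback ?P M)"
    by (simp add: pullback_def l)
  then have "int (count1 scale (pullback l M)) = bar_count (pullback h (pullback ?P M))"
    using count1_eq_bar_count rep0_pullback[OF assms(4,3,2)] by simp
  also have "\<dots> \<le> bar_count (pullback ?P M)"
    by (rule bar_count_pullback_le[OF P h])
  also have "\<dots> \<le> count2 scale M"
    by (rule bar_count_lattice_path_le[where g = g, OF assms(4) g])
  finally show ?thesis .
qed

end
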